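(* Suppose that $P$ is a $d$-dimensional 0-1 matrix of dimensions $k_1 \times \dots \times k_d$, and $P'$ is the $(d+1)$-dimensional 0-1 matrix of dimensions $k_1 \times \dots \times k_d \times k_d$ obtained from $P$ by replacing each $1$-entry at coordinate $(x_1, \dots, x_d)$ with a $1$-entry at coordinate $(x_1, \dots, x_d, x_d)$ (all other entries of $P'$ being $0$). Then $\operatorname{ex}(n, P', d+1) = \Theta(n \operatorname{ex}(n, P, d))$.
   Context: A 0-1 matrix is a (multidimensional) matrix all of whose entries are $0$ or $1$; coordinates in a dimension of length $m$ range over $\{1,\dots,m\}$. A $d$-dimensional 0-1 matrix $A$ contains a $d$-dimensional 0-1 matrix $P$ if $A$ has a submatrix (obtained by restricting each of the $d$ coordinates to a subset of its range) of the same dimensions as $P$ that can be turned into $P$ by changing any number of $1$-entries to $0$-entries; otherwise $A$ avoids $P$ (is $P$-free). $\operatorname{ex}(n,P,d)$ is the maximum possible number of $1$-entries in a $P$-free $d$-dimensional 0-1 matrix of dimensions $n\times n\times\dots\times n$ (taken to be $0$ if no such matrix exists). Asymptotic notation is for $n\to\infty$ with $P$ and $d$ fixed. *)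

theory Defs
  imports Complex_Main "HOL-Library.FuncSet" "HOL-Library.Landau_Symbols"
begin

text \<open>
  Multidimensional coordinates are lists of naturals, counted from 1 in each dimension.  A matrix
  with dimensions \<open>ks\<close> has \<open>length ks\<close> many dimensions; it is an extensional function on the
  index box of \<open>ks\<close>, so that equality of functions is equality of matrices and there are only
  finitely many 0-1 matrices of given dimensions.
\<close>

definition index_box :: "nat list \<Rightarrow> nat list set" where
  "index_box ks = {x. length x = length ks \<and> (\<forall>i<length ks. x ! i \<in> {1..ks ! i})}"

definition zero_one_matrices :: "nat list \<Rightarrow> (nat list \<Rightarrow> nat) set" where
  "zero_one_matrices ks = index_box ks \<rightarrow>\<^sub>E {0, 1}"

definition num_ones :: "nat list \<Rightarrow> (nat list \<Rightarrow> nat) \<Rightarrow> nat" where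
  "num_ones ks A = card {x \<in> index_box ks. A x = 1}"

text \<open>
  The submatrix of \<open>A\<close> in which the \<open>i\<close>-th coordinate is restricted to the finite set \<open>Ss ! i\<close>.
  Restricted coordinates are renumbered increasingly from 1: coordinate \<open>j\<close> of the submatrix stands
  for the \<open>j\<close>-th smallest element of \<open>Ss ! i\<close>.  List positions count from 0, hence \<open>j - 1\<close>.
\<close>

definition submatrix :: "nat set list \<Rightarrow> (nat list \<Rightarrow> nat) \<Rightarrow> nat list \<Rightarrow> nat" where
  "submatrix Ss A =
     restrict (\<lambda>x. A (map2 (\<lambda>S j. sorted_list_of_set S ! (j - 1)) Ss x)) (index_box (map card Ss))"

text \<open>\<open>A\<close> has dimensions \<open>ns\<close> and \<open>P\<close> has dimensions \<open>ks\<close>; \<open>Z\<close> is the set of changed 1-entries.\<close>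

definition contains_matrix ::
    "nat list \<Rightarrow> (nat list \<Rightarrow> nat) \<Rightarrow> nat list \<Rightarrow> (nat list \<Rightarrow> nat) \<Rightarrow> bool" where
  "contains_matrix ns A ks P \<longleftrightarrow>
     (\<exists>Ss Z. length Ss = length ns \<and> (\<forall>i<length ns. Ss ! i \<subseteq> {1..ns ! i}) \<and>
        map card Ss = ks \<and>
        Z \<subseteq> {x \<in> index_box ks. submatrix Ss A x = 1} \<and>
        P = (\<lambda>x. if x \<in> Z then 0 else submatrix Ss A x))"

definition free_matrices ::
    "nat list \<Rightarrow> nat list \<Rightarrow> (nat list \<Rightarrow> nat) \<Rightarrow> (nat list \<Rightarrow> nat) set" where
  "free_matrices ns ks P = {A \<in> zero_one_matrices ns. \<not> contains_matrix ns A ks P}"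

text \<open>The extremal function \<open>ex(n, P, d)\<close>, where \<open>P\<close> has dimensions \<open>ks\<close>.\<close>

definition ex_matrix :: "nat \<Rightarrow> nat list \<Rightarrow> (nat list \<Rightarrow> nat) \<Rightarrow> nat \<Rightarrow> nat" where
  "ex_matrix n ks P d =
     (if free_matrices (replicate d n) ks P = {} then 0
      else Max (num_ones (replicate d n) ` free_matrices (replicate d n) ks P))"

text \<open>The matrix \<open>P'\<close>, of dimensions \<open>ks @ [last ks]\<close>, obtained by repeating the last coordinate
  of every 1-entry of \<open>P\<close>.\<close>

definition repeat_last :: "nat list \<Rightarrow> (nat list \<Rightarrow> nat) \<Rightarrow> nat list \<Rightarrow> nat" where
  "repeat_last ks P =
     restrict (\<lambda>y. if \<exists>x \<in> index_box ks. P x = 1 \<and> y = x @ [last x] then 1 else 0)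
       (index_box (ks @ [last ks]))"

end

theory Submission
  imports Defs
begin

text \<open>
  Restricting to submatrices amounts to choosing a strictly increasing map in each dimension.

  Lower bound: if \<open>A\<close> avoids \<open>P\<close>, then so do, with \<open>P'\<close> in place of \<open>P\<close>, the two matrices with
  entries \<open>A(x, min a b)\<close> and \<open>A(x, max a b)\<close> at \<open>(x, a, b)\<close>, because \<open>min\<close> and \<open>max\<close> are strictly
  increasing along increasing pairs.  For each 1-entry \<open>(x, t)\<close> of \<open>A\<close> and each \<open>b\<close>, one of the
  two matrices has a 1-entry at \<open>(x, t, b)\<close>.

  Upper bound: the 1-entries \<open>(x, a, b)\<close> of a \<open>P'\<close>-free matrix are split by the value of \<open>b - a\<close>.
  Each of the \<open>2n - 1\<close> classes is a \<open>P\<close>-free matrix whose last dimension is shorter than \<open>n\<close>.  It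
  is extended to length \<open>n\<close> by inserting zero layers in front of its last \<open>e\<close> layers, where \<open>e\<close> is
  the number of zero layers at the end of \<open>P\<close>.  Thus no copy of \<open>P\<close> can have a 1-entry behind the
  inserted layers, and a copy in front of them would leave room for \<open>e\<close> further layers.
\<close>

section \<open>Matrices as sets of 1-entries, submatrices as increasing maps\<close>

definition ones :: "nat list \<Rightarrow> (nat list \<Rightarrow> nat) \<Rightarrow> nat list set" where
  "ones ks P = {x \<in> index_box ks. P x = 1}"

definition box_embedding :: "nat list \<Rightarrow> nat list \<Rightarrow> (nat \<Rightarrow> nat \<Rightarrow> nat) \<Rightarrow> bool" where
  "box_embedding ks ns f \<longleftrightarrow>
     (\<forall>i<length ks. strict_mono_on {1..ks ! i} (f i) \<and> f i ` {1..ks ! i} \<subseteq> {1..ns ! i})"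

definition map_coords :: "(nat \<Rightarrow> nat \<Rightarrow> nat) \<Rightarrow> nat list \<Rightarrow> nat list" where
  "map_coords f x = map (\<lambda>i. f i (x ! i)) [0..<length x]"

text \<open>A pattern is given by its 1-entries \<open>Q\<close> together with its dimensions
  \<open>ks\<close>. The dimensions matter: an embedding must also find room for the zero layers of
  the pattern.\<close>

definition avoids :: "nat list \<Rightarrow> nat list set \<Rightarrow> nat list \<Rightarrow> nat list set \<Rightarrow> bool" where
  "avoids ns U ks Q \<longleftrightarrow> (\<nexists>f. box_embedding ks ns f \<and> map_coords f ` Q \<subseteq> U)"

lemma length_map_coords [simp]: "length (map_coords f x) = length x"
  by (simp add: map_coords_def)

lemma map_coords_snoc [simp]: "map_coords f (x @ [a]) = map_coords f x @ [f (length x) a]"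
  by (auto simp: map_coords_def nth_append)

lemma map_coords_append2 [simp]:
  "map_coords f (x @ [a, b]) = map_coords f x @ [f (length x) a, f (Suc (length x)) b]"
  using map_coords_snoc [of f "x @ [a]" b] by simp

lemma map_coords_cong:
  assumes "\<And>i. i < length x \<Longrightarrow> f i = g i"
  shows "map_coords f x = map_coords g x"
  using assms by (simp add: map_coords_def)

lemma index_box_snoc [simp]:
  "x @ [a] \<in> index_box (ks @ [k]) \<longleftrightarrow> x \<in> index_box ks \<and> a \<in> {1..k}"
  by (auto simp: index_box_def nth_append less_Suc_eq)

lemma index_box_append2 [simp]:
  "x @ [a, b] \<in> index_box (ks @ [k, l]) \<longleftrightarrow> x \<in> index_box ks \<and> a \<in> {1..k} \<and> b \<in> {1..l}"
  using index_box_snoc [of "x @ [a]" b "ks @ [k]" l] by simp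

lemma index_box_snocE:
  assumes "y \<in> index_box (ks @ [k])"
  obtains x a where "y = x @ [a]" "x \<in> index_box ks" "a \<in> {1..k}"
proof -
  have "y = butlast y @ [last y]"
    using assms by (cases y rule: rev_cases) (auto simp: index_box_def)
  then show ?thesis using assms that index_box_snoc by metis
qed

lemma index_box_append2E:
  assumes "y \<in> index_box (ks @ [k, l])"
  obtains x a b where "y = x @ [a, b]" "x \<in> index_box ks" "a \<in> {1..k}" "b \<in> {1..l}"
proof -
  from assms have "y \<in> index_box ((ks @ [k]) @ [l])" by simp
  then obtain z b where z: "y = z @ [b]" "z \<in> index_box (ks @ [k])" "b \<in> {1..l}"
    by (rule index_box_snocE)
  from z(2) obtain x a where "z = x @ [a]" "x \<in> index_box ks" "a \<in> {1..k}"
    by (rule index_box_snocE)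
  with z that show ?thesis by simp
qed

lemma length_index_box: "x \<in> index_box ks \<Longrightarrow> length x = length ks"
  by (simp add: index_box_def)

lemma finite_index_box: "finite (index_box ks)"
proof (rule finite_subset)
  show "index_box ks \<subseteq> {x. set x \<subseteq> {..sum_list ks} \<and> length x = length ks}"
    by (force simp: index_box_def in_set_conv_nth intro: order_trans [OF _ member_le_sum_list])
qed (simp add: finite_lists_length_eq)

lemma box_embedding_snoc:
  assumes "length ks = length ns"
  shows "box_embedding (ks @ [k]) (ns @ [n]) f \<longleftrightarrow>
    box_embedding ks ns f \<and> strict_mono_on {1..k} (f (length ks)) \<and>
    f (length ks) ` {1..k} \<subseteq> {1..n}"
  using assms by (simp add: box_embedding_def All_less_Suc nth_append conj_ac)

lemma box_embedding_append2:
  assumes "length ks = length ns"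
  shows "box_embedding (ks @ [k, l]) (ns @ [n, m]) f \<longleftrightarrow>
    box_embedding ks ns f \<and>
    strict_mono_on {1..k} (f (length ks)) \<and> f (length ks) ` {1..k} \<subseteq> {1..n} \<and>
    strict_mono_on {1..l} (f (Suc (length ks))) \<and> f (Suc (length ks)) ` {1..l} \<subseteq> {1..m}"
  using box_embedding_snoc [of "ks @ [k]" "ns @ [n]" l m f] box_embedding_snoc [of ks ns k n f] assms
  by auto

lemma box_embedding_cong:
  assumes "\<And>i. i < length ks \<Longrightarrow> f i = g i"
  shows "box_embedding ks ns f = box_embedding ks ns g"
  using assms by (simp add: box_embedding_def)

lemma map_coords_in_box:
  assumes "box_embedding ks ns f" "length ns = length ks" "x \<in> index_box ks"
  shows "map_coords f x \<in> index_box ns"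
  using assms unfolding box_embedding_def index_box_def map_coords_def
  by (simp add: image_subset_iff)

section \<open>Containment in terms of embeddings\<close>

lemma nth_sorted_list_of_set_image:
  fixes f :: "nat \<Rightarrow> nat"
  assumes "strict_mono_on {1..k} f" "j \<in> {1..k}"
  shows "sorted_list_of_set (f ` {1..k}) ! (j - 1) = f j"
proof -
  have "sorted_wrt (<) (map f [1..<Suc k])"
    unfolding sorted_wrt_iff_nth_less using assms(1)
    by (auto simp: strict_mono_on_def simp del: upt_Suc)
  then have "sorted_list_of_set (set (map f [1..<Suc k])) = map f [1..<Suc k]"
    by (simp only: strict_sorted_iff sorted_list_of_set.idem_if_sorted_distinct)
  moreover have "set (map f [1..<Suc k]) = f ` {1..k}"
    by (simp add: atLeastLessThanSuc_atLeastAtMost del: upt_Suc)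
  ultimately have "sorted_list_of_set (f ` {1..k}) = map f [1..<Suc k]" by simp
  then show ?thesis using assms(2) by (auto simp del: upt_Suc)
qed

text \<open>Index sets and increasing maps determine each other: \<open>f i\<close> enumerates
  \<open>Ss ! i\<close>, and \<open>Ss ! i\<close> is the image of \<open>f i\<close>. Since surplus
  1-entries may be changed to 0, only the 1-entries of \<open>P\<close> have to be matched.\<close>

lemma contains_matrix_iff:
  assumes len: "length ns = length ks"
    and A: "A \<in> zero_one_matrices ns" and P: "P \<in> zero_one_matrices ks"
  shows "contains_matrix ns A ks P \<longleftrightarrow> \<not> avoids ns (ones ns A) ks (ones ks P)"
proof
  assume "contains_matrix ns A ks P"
  then obtain Ss Z where Ss: "length Ss = length ns" "\<forall>i<length ns. Ss ! i \<subseteq> {1..ns ! i}"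
      "map card Ss = ks"
    and PZ: "P = (\<lambda>x. if x \<in> Z then 0 else submatrix Ss A x)"
    unfolding contains_matrix_def by (elim exE conjE) (rule that)
  define f where "f = (\<lambda>i j. sorted_list_of_set (Ss ! i) ! (j - 1))"
  have emb: "box_embedding ks ns f"
    unfolding box_embedding_def
  proof (intro allI impI conjI)
    fix i assume i: "i < length ks"
    have fin: "finite (Ss ! i)" using Ss(2) i len by (auto intro: finite_subset)
    have k: "ks ! i = card (Ss ! i)" using Ss(1,3) i len by (metis nth_map)
    have "sorted_wrt (<) (sorted_list_of_set (Ss ! i))" by simp
    then show "strict_mono_on {1..ks ! i} (f i)"
      unfolding strict_mono_on_def f_def sorted_wrt_iff_nth_less
      by (auto simp: k)
    have "f i j \<in> Ss ! i" if "j \<in> {1..ks ! i}" for j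
    proof -
      have "f i j \<in> set (sorted_list_of_set (Ss ! i))"
        unfolding f_def using that by (intro nth_mem) (auto simp: k)
      then show ?thesis using fin by simp
    qed
    moreover have "Ss ! i \<subseteq> {1..ns ! i}" using Ss(2) i len by simp
    ultimately show "f i ` {1..ks ! i} \<subseteq> {1..ns ! i}" by blast
  qed
  have "map_coords f x \<in> ones ns A" if x: "x \<in> ones ks P" for x
  proof -
    have xb: "x \<in> index_box ks" and Px: "P x = 1" using x by (auto simp: ones_def)
    have lx: "length x = length Ss" using xb length_index_box Ss(1) len by simp
    have eq: "map2 (\<lambda>S j. sorted_list_of_set S ! (j - 1)) Ss x = map_coords f x"
      using lx by (intro nth_equalityI) (auto simp: f_def map_coords_def)
    have "submatrix Ss A x = 1" using Px fun_cong [OF PZ, of x] by (simp split: if_splits)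
    then have "A (map_coords f x) = 1"
      using xb by (simp add: submatrix_def Ss(3) flip: eq)
    then show ?thesis using map_coords_in_box [OF emb len xb] by (simp add: ones_def)
  qed
  with emb show "\<not> avoids ns (ones ns A) ks (ones ks P)" unfolding avoids_def by blast
next
  assume "\<not> avoids ns (ones ns A) ks (ones ks P)"
  then obtain f where emb: "box_embedding ks ns f" and sub: "map_coords f ` ones ks P \<subseteq> ones ns A"
    unfolding avoids_def by blast
  define Ss where "Ss = map (\<lambda>i. f i ` {1..ks ! i}) [0..<length ks]"
  \<comment> \<open>Exactly the surplus 1-entries of the submatrix have to be changed.\<close>
  define Z where "Z = {x \<in> index_box ks. submatrix Ss A x = 1 \<and> P x = 0}"
  have card: "map card Ss = ks"
  proof (rule nth_equalityI)
    fix i assume "i < length (map card Ss)"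
    then have "i < length ks" by (simp add: Ss_def)
    then show "map card Ss ! i = ks ! i"
      using emb strict_mono_on_imp_inj_on card_image unfolding box_embedding_def Ss_def
      by fastforce
  qed (simp add: Ss_def)
  have sm: "submatrix Ss A x = A (map_coords f x)" if x: "x \<in> index_box ks" for x
  proof -
    have "map2 (\<lambda>S j. sorted_list_of_set S ! (j - 1)) Ss x = map_coords f x"
    proof (rule nth_equalityI)
      fix i assume "i < length (map2 (\<lambda>S j. sorted_list_of_set S ! (j - 1)) Ss x)"
      then have i: "i < length ks" "i < length x" by (auto simp: Ss_def)
      have "strict_mono_on {1..ks ! i} (f i)" "x ! i \<in> {1..ks ! i}"
        using emb x i by (auto simp: box_embedding_def index_box_def)
      from nth_sorted_list_of_set_image [OF this] i
      show "map2 (\<lambda>S j. sorted_list_of_set S ! (j - 1)) Ss x ! i = map_coords f x ! i"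
        by (simp add: Ss_def map_coords_def)
    qed (use length_index_box [OF x] in \<open>simp add: Ss_def\<close>)
    then show ?thesis using x by (simp add: submatrix_def card)
  qed
  have "P x = (if x \<in> Z then 0 else submatrix Ss A x)" for x
  proof (cases "x \<in> index_box ks")
    case True
    have "P x = 0 \<or> P x = 1" using P True by (auto simp: zero_one_matrices_def)
    moreover have "A (map_coords f x) = 0 \<or> A (map_coords f x) = 1"
      using A map_coords_in_box [OF emb len True] by (auto simp: zero_one_matrices_def)
    moreover have "A (map_coords f x) = 1" if "P x = 1"
      using sub True that by (auto simp: ones_def)
    moreover have "x \<in> Z \<longleftrightarrow> A (map_coords f x) = 1 \<and> P x = 0"
      using True sm [OF True] by (simp add: Z_def)
    ultimately show ?thesis using sm [OF True] by auto
  next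
    case False
    \<comment> \<open>Equality of functions is also required outside the box, where \<open>P\<close>
      and the submatrix both take the default value.\<close>
    then have "P x = undefined" using P unfolding zero_one_matrices_def by (rule PiE_arb [rotated])
    then show ?thesis using False by (simp add: Z_def submatrix_def card)
  qed
  then have "P = (\<lambda>x. if x \<in> Z then 0 else submatrix Ss A x)" by (rule ext)
  moreover have "Z \<subseteq> {x \<in> index_box ks. submatrix Ss A x = 1}" by (auto simp: Z_def)
  moreover have "length Ss = length ns" by (simp add: Ss_def len)
  moreover have "\<forall>i<length ns. Ss ! i \<subseteq> {1..ns ! i}"
    using len emb by (simp add: Ss_def box_embedding_def)
  ultimately show "contains_matrix ns A ks P"
    unfolding contains_matrix_def using card
    by (intro exI [of _ Ss] exI [of _ Z] conjI) assumption+
qed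

section \<open>The extremal function as a largest size of an avoiding set\<close>

lemma finite_free_matrices: "finite (free_matrices ns ks P)"
proof (rule finite_subset)
  show "free_matrices ns ks P \<subseteq> zero_one_matrices ns" by (auto simp: free_matrices_def)
  show "finite (zero_one_matrices ns)"
    unfolding zero_one_matrices_def by (intro finite_PiE finite_index_box) auto
qed

lemma card_le_ex_matrix:
  assumes "length ks = d" "P \<in> zero_one_matrices ks"
    and U: "U \<subseteq> index_box (replicate d n)" and "avoids (replicate d n) U ks (ones ks P)"
  shows "card U \<le> ex_matrix n ks P d"
proof -
  define A where "A = restrict (\<lambda>x. if x \<in> U then 1 else 0 :: nat) (index_box (replicate d n))"
  have A: "A \<in> zero_one_matrices (replicate d n)"
    by (auto simp: A_def zero_one_matrices_def)
  have oA: "ones (replicate d n) A = U"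
    using U by (auto simp: A_def ones_def)
  have "A \<in> free_matrices (replicate d n) ks P"
    using A oA assms contains_matrix_iff [of "replicate d n" ks A P] by (simp add: free_matrices_def)
  moreover have "num_ones (replicate d n) A = card U"
    using oA by (simp add: num_ones_def ones_def)
  ultimately show ?thesis
    unfolding ex_matrix_def using finite_free_matrices
    by (auto intro!: Max_ge simp flip: \<open>num_ones (replicate d n) A = card U\<close>)
qed

text \<open>A nonzero value excludes the default 0 for the case that no free matrix exists, so the
  maximum is taken over a nonempty finite set.\<close>

lemma ex_matrix_attained:
  assumes "length ks = d" "P \<in> zero_one_matrices ks" "ex_matrix n ks P d \<noteq> 0"
  obtains U where "U \<subseteq> index_box (replicate d n)" "avoids (replicate d n) U ks (ones ks P)"
    "card U = ex_matrix n ks P d"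
proof -
  let ?F = "free_matrices (replicate d n) ks P"
  have "?F \<noteq> {}" and ex: "ex_matrix n ks P d = Max (num_ones (replicate d n) ` ?F)"
    using assms(3) by (auto simp: ex_matrix_def split: if_splits)
  then have "ex_matrix n ks P d \<in> num_ones (replicate d n) ` ?F"
    using finite_free_matrices by (simp add: Max_in)
  then obtain A where A: "A \<in> ?F" "num_ones (replicate d n) A = ex_matrix n ks P d" by force
  show ?thesis
  proof (rule that)
    show "ones (replicate d n) A \<subseteq> index_box (replicate d n)" by (auto simp: ones_def)
    show "avoids (replicate d n) (ones (replicate d n) A) ks (ones ks P)"
      using A assms contains_matrix_iff [of "replicate d n" ks A P] by (simp add: free_matrices_def)
    show "card (ones (replicate d n) A) = ex_matrix n ks P d"
      using A by (simp add: num_ones_def ones_def)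
  qed
qed

section \<open>Lower bound\<close>

lemma repeat_last_zero_one: "repeat_last ks P \<in> zero_one_matrices (ks @ [last ks])"
  by (auto simp: repeat_last_def zero_one_matrices_def)

lemma ones_repeat_last:
  "ones ((ls @ [k]) @ [k]) (repeat_last (ls @ [k]) P) = (\<lambda>x. x @ [last x]) ` ones (ls @ [k]) P"
proof -
  have "x @ [last x] \<in> index_box (ls @ [k, k])" if "x \<in> index_box (ls @ [k])" for x
    using that by (auto elim!: index_box_snocE)
  then show ?thesis by (auto simp: ones_def repeat_last_def split: if_splits)
qed

text \<open>All 1-entries of the new pattern have equal last two coordinates, so in a copy of it the
  last two maps are evaluated at the same \<open>j\<close>. Combining them by \<open>m\<close> gives
  one increasing map, hence a copy of \<open>Q\<close> in \<open>U\<close>. It is applied with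
  \<open>m\<close> being \<open>min\<close> and \<open>max\<close>.\<close>

lemma avoids_collapse_last:
  assumes len: "length ls = length ns"
    and U: "avoids (ns @ [n]) U (ls @ [k]) Q" and Q: "Q \<subseteq> index_box (ls @ [k])"
    and V: "\<And>x a b. x @ [a, b] \<in> V \<Longrightarrow> x @ [m a b] \<in> U"
    and mono: "\<And>a b a' b'. a < a' \<Longrightarrow> b < b' \<Longrightarrow> m a b < m a' b'"
    and range: "\<And>a b. a \<in> {1..n} \<Longrightarrow> b \<in> {1..n} \<Longrightarrow> m a b \<in> {1..n :: nat}"
  shows "avoids (ns @ [n, n]) V (ls @ [k, k]) ((\<lambda>x. x @ [last x]) ` Q)"
  unfolding avoids_def
proof
  assume "\<exists>f. box_embedding (ls @ [k, k]) (ns @ [n, n]) f \<and>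
    map_coords f ` (\<lambda>x. x @ [last x]) ` Q \<subseteq> V"
  then obtain f where f: "box_embedding (ls @ [k, k]) (ns @ [n, n]) f"
    and fV: "map_coords f ` (\<lambda>x. x @ [last x]) ` Q \<subseteq> V" by blast
  let ?L = "length ls"
  define g where "g = f(?L := \<lambda>j. m (f ?L j) (f (Suc ?L) j))"
  note f' = f [unfolded box_embedding_append2 [OF len]]
  have gf: "g i = f i" if "i < ?L" for i using that by (simp add: g_def)
  have "strict_mono_on {1..k} (g ?L)"
    using f' mono unfolding strict_mono_on_def g_def by simp
  moreover have "g ?L ` {1..k} \<subseteq> {1..n}"
    using f' range unfolding g_def by (simp add: image_subset_iff)
  ultimately have "box_embedding (ls @ [k]) (ns @ [n]) g"
    using f' gf box_embedding_cong [of ls g f] by (simp add: box_embedding_snoc [OF len])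
  moreover have "map_coords g y \<in> U" if y: "y \<in> Q" for y
  proof -
    obtain x a where x: "y = x @ [a]" "x \<in> index_box ls"
      using y Q by (blast elim: index_box_snocE)
    have lx: "length x = ?L" using x length_index_box by blast
    have "map_coords f x @ [f ?L a, f (Suc ?L) a] \<in> V"
      using fV y x lx by force
    then have "map_coords f x @ [m (f ?L a) (f (Suc ?L) a)] \<in> U" by (rule V)
    moreover have "map_coords g x = map_coords f x"
      using gf lx by (intro map_coords_cong) simp
    ultimately show ?thesis using x lx by (simp add: g_def)
  qed
  ultimately show False using U unfolding avoids_def by blast
qed

lemma replicate_snoc: "replicate (Suc m) x = replicate m x @ [x]"
  by (simp add: replicate_append_same)

lemma ex_matrix_repeat_last_ge:
  assumes P: "P \<in> zero_one_matrices (ls @ [k])"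
  shows "n * ex_matrix n (ls @ [k]) P (Suc (length ls)) \<le>
    2 * ex_matrix n ((ls @ [k]) @ [k]) (repeat_last (ls @ [k]) P) (Suc (Suc (length ls)))"
    (is "n * ?ex \<le> 2 * ?ex'")
proof (cases "?ex = 0")
  case False
  let ?L = "length ls" and ?ns = "replicate (length ls) n" and ?Q = "ones (ls @ [k]) P"
  obtain U where U: "U \<subseteq> index_box (?ns @ [n])" "avoids (?ns @ [n]) U (ls @ [k]) ?Q"
    "card U = ?ex"
    using ex_matrix_attained [OF _ P False] unfolding replicate_snoc by auto
  define V where "V m = {x @ [a, b] | x a b. x @ [m a b] \<in> U \<and> a \<in> {1..n} \<and> b \<in> {1..n}}"
    for m :: "nat \<Rightarrow> nat \<Rightarrow> nat"
  have Vbox: "V m \<subseteq> index_box (?ns @ [n, n])" for m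
    using U(1) by (force simp: V_def)
  have fin: "finite (V m)" for m
    using Vbox finite_index_box by (rule finite_subset)
  have V: "card (V m) \<le> ?ex'"
    if m: "\<And>a b a' b'. a < a' \<Longrightarrow> b < b' \<Longrightarrow> m a b < m a' b'"
      "\<And>a b. a \<in> {1..n} \<Longrightarrow> b \<in> {1..n} \<Longrightarrow> m a b \<in> {1..n}" for m
  proof (rule card_le_ex_matrix)
    show "V m \<subseteq> index_box (replicate (Suc (Suc ?L)) n)"
      using Vbox by (simp add: replicate_snoc del: replicate_Suc)
    have "avoids (?ns @ [n, n]) (V m) (ls @ [k, k]) ((\<lambda>x. x @ [last x]) ` ?Q)"
    proof (rule avoids_collapse_last [OF _ U(2)])
      show "x @ [m a b] \<in> U" if "x @ [a, b] \<in> V m" for x a b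
        using that by (auto simp: V_def)
    qed (use m in \<open>auto simp: ones_def\<close>)
    then show "avoids (replicate (Suc (Suc ?L)) n) (V m) ((ls @ [k]) @ [k])
        (ones ((ls @ [k]) @ [k]) (repeat_last (ls @ [k]) P))"
      unfolding ones_repeat_last by (simp add: replicate_snoc del: replicate_Suc)
    show "repeat_last (ls @ [k]) P \<in> zero_one_matrices ((ls @ [k]) @ [k])"
      using repeat_last_zero_one [of "ls @ [k]" P] by simp
  qed simp
  have "card ((\<lambda>(u, b). u @ [b]) ` (U \<times> {1..n})) = n * ?ex"
    using U(3) by (subst card_image) (auto simp: inj_on_def card_cartesian_product)
  moreover have "(\<lambda>(u, b). u @ [b]) ` (U \<times> {1..n}) \<subseteq> V min \<union> V max"
  proof clarsimp
    fix u b assume u: "u \<in> U" and b: "Suc 0 \<le> b" "b \<le> n" and *: "u @ [b] \<notin> V max"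
    obtain x t where x: "u = x @ [t]" "t \<in> {1..n}"
      using u U(1) by (blast elim: index_box_snocE)
    have "u @ [b] = x @ [t, b]" using x by simp
    then show "u @ [b] \<in> V min"
      \<comment> \<open>The layer \<open>t\<close> equals \<open>min t b\<close> if
        \<open>t \<le> b\<close>, and \<open>max t b\<close> otherwise.\<close>
      using x u b * by (cases "t \<le> b") (auto simp: V_def min_def max_def)
  qed
  ultimately have "n * ?ex \<le> card (V min \<union> V max)"
    using fin by (metis card_mono finite_UnI)
  also have "\<dots> \<le> card (V min) + card (V max)" by (rule card_Un_le)
  also have "\<dots> \<le> ?ex' + ?ex'" by (intro add_mono V) auto
  finally show ?thesis by simp
qed simp

section \<open>Upper bound: cutting along diagonals\<close>

lemma strict_mono_on_add_diff_le:
  fixes f :: "nat \<Rightarrow> nat"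
  assumes "strict_mono_on {1..k} f" "1 \<le> i" "i \<le> j" "j \<le> k"
  shows "f i + (j - i) \<le> f j"
  using \<open>i \<le> j\<close> \<open>j \<le> k\<close>
proof (induction j rule: dec_induct)
  case (step j)
  then have "f j < f (Suc j)" using assms(1,2) by (auto simp: strict_mono_on_def)
  with step show ?case by simp
qed simp

text \<open>
  On the diagonal \<open>b - a = \<delta>\<close>, an entry is moved to the layer \<open>min a b\<close>, or to \<open>max a b\<close> if it lies
  in one of the last \<open>e\<close> layers.
\<close>

definition diag_layer :: "nat \<Rightarrow> nat \<Rightarrow> nat \<Rightarrow> nat \<Rightarrow> nat" where
  "diag_layer n e a b = (if max a b + e \<le> n then min a b else max a b)"

definition diag_slice :: "nat \<Rightarrow> nat \<Rightarrow> int \<Rightarrow> nat list set \<Rightarrow> nat list set" where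
  "diag_slice n e \<delta> V =
     {x @ [diag_layer n e a b] | x a b. x @ [a, b] \<in> V \<and> int b - int a = \<delta>}"

text \<open>On one diagonal either of \<open>min\<close> and \<open>max\<close> determines the pair.
  The two branches never meet: a value \<open>v\<close> from the \<open>min\<close> branch satisfies
  \<open>v + e \<le> n\<close>, one from the \<open>max\<close> branch does not.\<close>

lemma diag_layer_inj:
  assumes "diag_layer n e a b = diag_layer n e a' b'" "int b - int a = int b' - int a'"
  shows "a = a' \<and> b = b'"
  using assms unfolding diag_layer_def by (auto simp: max_def min_def split: if_splits)

text \<open>Such a layer can only come from the \<open>min\<close> branch, so it is the smaller
  coordinate. By truncation at least one of \<open>nat \<delta>\<close> and
  \<open>nat (- \<delta>)\<close> is 0, which covers both signs of \<open>\<delta>\<close> at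
  once.\<close>

lemma diag_layer_low:
  assumes "diag_layer n e a b + e \<le> n" "int b - int a = \<delta>"
  shows "a = diag_layer n e a b + nat (- \<delta>)" "b = diag_layer n e a b + nat \<delta>"
    "diag_layer n e a b + nat (- \<delta>) + e \<le> n" "diag_layer n e a b + nat \<delta> + e \<le> n"
  using assms unfolding diag_layer_def by (auto simp: max_def min_def split: if_splits)

text \<open>The 1-entries of a copy in the slice all lie in low layers, where the shift along the
  diagonal can be undone. This yields a copy of the doubled pattern in \<open>V\<close>, with last
  two maps differing by \<open>\<delta>\<close>.\<close>

lemma avoids_diag_slice:
  assumes len: "length ls = length ns"
    and V: "avoids (ns @ [n, n]) V (ls @ [k, k]) ((\<lambda>x. x @ [last x]) ` Q)"
    and Q: "Q \<subseteq> index_box (ls @ [k])"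
  shows "avoids (ns @ [n]) (diag_slice n (k - Max (last ` Q)) \<delta> V) (ls @ [k]) Q"
  unfolding avoids_def
proof
  let ?L = "length ls"
  define q where "q = Max (last ` Q)"
  define e where "e = k - q"
  let ?U = "diag_slice n (k - Max (last ` Q)) \<delta> V"
  assume "\<exists>f. box_embedding (ls @ [k]) (ns @ [n]) f \<and> map_coords f ` Q \<subseteq> ?U"
  then obtain f where f: "box_embedding (ls @ [k]) (ns @ [n]) f"
    and fU: "map_coords f ` Q \<subseteq> ?U" by blast
  define T where "T = f ?L"
  have emb: "box_embedding ls ns f" and T: "strict_mono_on {1..k} T" "T ` {1..k} \<subseteq> {1..n}"
    using f box_embedding_snoc [OF len] by (auto simp: T_def)
  \<comment> \<open>It suffices to find maps \<open>r\<close> and \<open>s\<close> for the last two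
    dimensions; the other dimensions keep \<open>f\<close>.\<close>
  have False if r: "strict_mono_on {1..k} r" "r ` {1..k} \<subseteq> {1..n}"
    and s: "strict_mono_on {1..k} s" "s ` {1..k} \<subseteq> {1..n}"
    and rs: "\<And>x i. x @ [i] \<in> Q \<Longrightarrow> map_coords f x @ [r i, s i] \<in> V" for r s
  proof -
    define g where "g = f(?L := r, Suc ?L := s)"
    have gf: "g i = f i" if "i < ?L" for i using that by (simp add: g_def)
    have "box_embedding (ls @ [k, k]) (ns @ [n, n]) g"
      using r s emb box_embedding_cong [of ls g f] gf
      by (simp add: box_embedding_append2 [OF len]) (simp add: g_def)
    moreover have "map_coords g (y @ [last y]) \<in> V" if y: "y \<in> Q" for y
    proof -
      obtain x i where x: "y = x @ [i]" "x \<in> index_box ls"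
        using y Q by (blast elim: index_box_snocE)
      have lx: "length x = ?L" using x length_index_box by blast
      have "map_coords g x = map_coords f x"
        using gf lx by (intro map_coords_cong) simp
      then show ?thesis using rs [of x i] y x lx by (simp add: g_def)
    qed
    ultimately show False using V unfolding avoids_def by blast
  qed note contra = this
  show False
  proof (cases "Q = {}")
    \<comment> \<open>Here \<open>Max\<close> says nothing about \<open>q\<close>, but any maps in
      range form a copy, so \<open>T\<close> serves twice.\<close>
    case True
    then show False using contra T by blast
  next
    case False
    have finQ: "finite Q" using Q finite_index_box by (rule finite_subset)
    then have "q \<in> last ` Q" unfolding q_def using False by (intro Max_in) auto
    then obtain x0 where x0: "x0 @ [q] \<in> Q" and q: "1 \<le> q" "q \<le> k"
      using Q by (force elim!: index_box_snocE)
    have le_q: "i \<in> {1..q}" and lx: "length x = ?L" if "x @ [i] \<in> Q" for x i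
    proof -
      have "i \<le> q" unfolding q_def using that finQ by (force intro: Max_ge)
      then show "i \<in> {1..q}" "length x = ?L"
        using that Q length_index_box [of x ls] by auto
    qed
    \<comment> \<open>Behind layer \<open>q\<close> the pattern has \<open>e = k - q\<close> further
      layers, and \<open>T\<close> must fit them below \<open>n\<close>.\<close>
    have Tq: "T q + e \<le> n"
      proof -
      have "T k \<in> {1..n}" using T(2) q by (force simp: image_subset_iff)
      then show ?thesis
        using strict_mono_on_add_diff_le [OF T(1), of q k] q by (simp add: e_def)
    qed
    have low: "map_coords f x @ [T i + nat (- \<delta>), T i + nat \<delta>] \<in> V \<and>
        T i + nat (- \<delta>) + e \<le> n \<and> T i + nat \<delta> + e \<le> n"
      if xi: "x @ [i] \<in> Q" for x i
    proof -
      have "map_coords f (x @ [i]) \<in> ?U" using fU xi by blast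
      then have "map_coords f x @ [T i] \<in> ?U"
        using lx [OF xi] by (simp add: T_def)
      then obtain a b where ab: "map_coords f x @ [a, b] \<in> V" "int b - int a = \<delta>"
        "T i = diag_layer n e a b"
        by (auto simp: diag_slice_def e_def q_def)
      have "T i \<le> T q"
        using strict_mono_on_add_diff_le [OF T(1), of i q] le_q [OF xi] q by auto
      then have "diag_layer n e a b + e \<le> n" using ab Tq by simp
      from diag_layer_low [OF this ab(2)] ab show ?thesis by metis
    qed
    \<comment> \<open>The layers of \<open>P\<close> behind \<open>q\<close> are zero, so they may be placed anywhere; only the first
      \<open>q\<close> values of \<open>T\<close> are known to stay in range after the shift by \<open>\<delta>\<close>.\<close>
    define t where "t j = (if j \<le> q then T j else T q + (j - q))" for j
    have t_mono: "t i < t j" if "1 \<le> i" "i < j" for i j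
    proof (cases "i \<le> q")
      case True
      have "T i + (min j q - i) \<le> T (min j q)"
        using strict_mono_on_add_diff_le [OF T(1), of i "min j q"] that q True by auto
      then show ?thesis using that True by (auto simp: t_def min_def split: if_splits)
    qed (use that in \<open>auto simp: t_def\<close>)
    \<comment> \<open>The padding grows by steps of 1, so it ends exactly at \<open>T q + e\<close>,
      which may be smaller than \<open>T k\<close>.\<close>
    have t_le: "t j \<le> T q + e" if "1 \<le> j" "j \<le> k" for j
      using that strict_mono_on_add_diff_le [OF T(1), of j q] q by (auto simp: t_def e_def)
    have t_ge: "1 \<le> t j" if "1 \<le> j" "j \<le> k" for j
      using that T(2) q by (force simp: t_def)
    have tV: "map_coords f x @ [t i + nat (- \<delta>), t i + nat \<delta>] \<in> V" if "x @ [i] \<in> Q" for x i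
      using low [OF that] le_q [OF that] by (simp add: t_def)
    have range: "(\<lambda>j. t j + c) ` {1..k} \<subseteq> {1..n}" if "T q + c + e \<le> n" for c
      using that t_le t_ge by (fastforce intro: trans_le_add1)
    have mono: "strict_mono_on {1..k} (\<lambda>j. t j + c)" for c
      using t_mono by (simp add: strict_mono_on_def)
    show False
      \<comment> \<open>The entry \<open>x0 @ [q]\<close> makes \<open>low\<close> bound
        \<open>T q + e\<close> after either shift, which is what \<open>range\<close>
        requires.\<close>
      by (rule contra [of "\<lambda>j. t j + nat (- \<delta>)" "\<lambda>j. t j + nat \<delta>"])
        (use mono range tV low [OF x0] in blast)+
  qed
qed

lemma ex_matrix_repeat_last_le:
  assumes P: "P \<in> zero_one_matrices (ls @ [k])"
  shows "ex_matrix n ((ls @ [k]) @ [k]) (repeat_last (ls @ [k]) P) (Suc (Suc (length ls))) \<le>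
    (2 * n + 1) * ex_matrix n (ls @ [k]) P (Suc (length ls))"
    (is "?ex' \<le> _ * ?ex")
proof (cases "?ex' = 0")
  case False
  let ?L = "length ls" and ?ns = "replicate (length ls) n" and ?Q = "ones (ls @ [k]) P"
  have "repeat_last (ls @ [k]) P \<in> zero_one_matrices ((ls @ [k]) @ [k])"
    using repeat_last_zero_one [of "ls @ [k]" P] by simp
  from ex_matrix_attained [OF _ this False]
  obtain V where V: "V \<subseteq> index_box (?ns @ [n, n])" "card V = ?ex'"
    "avoids (?ns @ [n, n]) V (ls @ [k, k]) ((\<lambda>x. x @ [last x]) ` ?Q)"
    unfolding ones_repeat_last by (auto simp: replicate_snoc simp del: replicate_Suc)
  have finV: "finite V" using V(1) finite_index_box by (rule finite_subset)
  define e where "e = k - Max (last ` ?Q)"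
  define W where "W \<delta> = {x @ [a, b] | x a b. x @ [a, b] \<in> V \<and> int b - int a = \<delta>}" for \<delta>
  have W: "card (W \<delta>) \<le> ?ex" for \<delta>
  proof -
    let ?U = "diag_slice n e \<delta> V"
    have Ubox: "?U \<subseteq> index_box (?ns @ [n])"
    proof
      fix y assume "y \<in> ?U"
      then obtain x a b where y: "y = x @ [diag_layer n e a b]" "x @ [a, b] \<in> V"
        by (auto simp: diag_slice_def)
      then have "x @ [a, b] \<in> index_box (?ns @ [n, n])" using V(1) by blast
      then show "y \<in> index_box (?ns @ [n])"
        unfolding y index_box_snoc index_box_append2 by (auto simp: diag_layer_def)
    qed
    \<comment> \<open>This map moves an entry of the diagonal to its place in the slice; it is
      injective on \<open>W \<delta>\<close> and transfers the bound on the slice to the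
      diagonal.\<close>
    define h where "h y = butlast (butlast y) @ [diag_layer n e (last (butlast y)) (last y)]" for y
    have h: "h (x @ [a, b]) = x @ [diag_layer n e a b]" for x a b
      by (simp add: h_def butlast_append)
    have "inj_on h (W \<delta>)"
    proof (rule inj_onI)
      fix y z assume "y \<in> W \<delta>" "z \<in> W \<delta>" and eq: "h y = h z"
      then obtain x a b x' a' b' where yz: "y = x @ [a, b]" "z = x' @ [a', b']"
        and \<delta>: "int b - int a = int b' - int a'"
        unfolding W_def by auto
      have "x = x'" "diag_layer n e a b = diag_layer n e a' b'"
        using eq by (simp_all add: yz h)
      with diag_layer_inj [OF _ \<delta>] show "y = z" by (simp add: yz)
    qed
    moreover have "h ` W \<delta> \<subseteq> ?U"
    proof (rule image_subsetI)
      fix y assume "y \<in> W \<delta>"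
      then obtain x a b where "y = x @ [a, b]" "x @ [a, b] \<in> V" "int b - int a = \<delta>"
        by (auto simp: W_def)
      then show "h y \<in> ?U" unfolding diag_slice_def using h by blast
    qed
    moreover have "finite ?U" using Ubox finite_index_box by (rule finite_subset)
    ultimately have "card (W \<delta>) \<le> card ?U" by (rule card_inj_on_le)
    also have "card ?U \<le> ?ex"
    proof (rule card_le_ex_matrix [OF _ P])
      have "avoids (?ns @ [n]) ?U (ls @ [k]) ?Q"
        unfolding e_def by (rule avoids_diag_slice [OF _ V(3)]) (auto simp: ones_def)
      then show "avoids (replicate (Suc ?L) n) ?U (ls @ [k]) ?Q"
        by (simp only: replicate_snoc)
    qed (use Ubox in \<open>simp_all add: replicate_snoc del: replicate_Suc\<close>)
    finally show ?thesis .
  qed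
  \<comment> \<open>Differences lie strictly between \<open>- n\<close> and \<open>n\<close>; the
    two empty end classes only simplify the count to \<open>2 * n + 1\<close>.\<close>
  have "V \<subseteq> (\<Union>\<delta>\<in>{- int n..int n}. W \<delta>)"
  proof
    fix y assume y: "y \<in> V"
    then obtain x a b where "y = x @ [a, b]" "a \<in> {1..n}" "b \<in> {1..n}"
      using V(1) by (blast elim: index_box_append2E)
    with y show "y \<in> (\<Union>\<delta>\<in>{- int n..int n}. W \<delta>)"
      by (intro UN_I [of "int b - int a"]) (auto simp: W_def)
  qed
  moreover have "finite (W \<delta>)" for \<delta>
    by (rule finite_subset [OF _ finV]) (auto simp: W_def)
  ultimately have "card V \<le> card (\<Union>\<delta>\<in>{- int n..int n}. W \<delta>)"
    by (intro card_mono) auto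
  also have "\<dots> \<le> (\<Sum>\<delta>\<in>{- int n..int n}. card (W \<delta>))" by (rule card_UN_le) simp
  also have "\<dots> \<le> (\<Sum>\<delta>\<in>{- int n..int n}. ?ex)" by (intro sum_mono W)
  also have "\<dots> = (2 * n + 1) * ?ex" by (simp add: nat_add_distrib nat_mult_distrib)
  finally show ?thesis using V(2) by simp
qed simp

theorem theorem3p5:
  fixes d :: nat and ks :: "nat list" and P :: "nat list \<Rightarrow> nat"
  assumes "d \<ge> 1"
    and "length ks = d"
    and "P \<in> zero_one_matrices ks"
  shows "(\<lambda>n. real (ex_matrix n (ks @ [last ks]) (repeat_last ks P) (d + 1)))
           \<in> \<Theta>(\<lambda>n. real n * real (ex_matrix n ks P d))"
proof -
  obtain ls k where ks: "ks = ls @ [k]"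
    using assms(1,2) by (cases ks rule: rev_cases) auto
  have d: "d = Suc (length ls)" using ks assms(2) by simp
  let ?ex = "\<lambda>n. ex_matrix n ks P d"
  let ?ex' = "\<lambda>n. ex_matrix n (ks @ [last ks]) (repeat_last ks P) (d + 1)"
  have lower: "n * ?ex n \<le> 2 * ?ex' n" and upper: "?ex' n \<le> (2 * n + 1) * ?ex n" for n
    using ex_matrix_repeat_last_ge [of P ls k n] ex_matrix_repeat_last_le [of P ls k n] assms(3)
    by (simp_all add: ks d)
  show ?thesis
  proof (rule bigthetaI)
    show "(\<lambda>n. real (?ex' n)) \<in> O(\<lambda>n. real n * real (?ex n))"
    proof (rule bigoI [where c = 3])
      show "\<forall>\<^sub>F n in sequentially. norm (real (?ex' n)) \<le> 3 * norm (real n * real (?ex n))"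
        using eventually_ge_at_top [of 1]
      proof eventually_elim
        case (elim n)
        \<comment> \<open>For \<open>n \<ge> 1\<close>,
          \<open>2 * n + 1 \<le> 3 * n\<close>.\<close>
        have "?ex' n \<le> (3 * n) * ?ex n"
          using elim by (intro order_trans [OF upper] mult_right_mono) auto
        then have "real (?ex' n) \<le> real ((3 * n) * ?ex n)" by (simp only: of_nat_le_iff)
        then show ?case by simp
      qed
    qed
    show "(\<lambda>n. real (?ex' n)) \<in> \<Omega>(\<lambda>n. real n * real (?ex n))"
      unfolding bigomega_iff_bigo
    proof (rule bigoI [where c = 2], rule always_eventually, rule allI)
      fix n
      have "real (n * ?ex n) \<le> real (2 * ?ex' n)" using lower by (simp only: of_nat_le_iff)
      then show "norm (real n * real (?ex n)) \<le> 2 * norm (real (?ex' n))" by simp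
    qed
  qed
qed

end
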